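(* Let $p$ be a polynomial in two variables. There is a constant $C>0$, depending only on $p$, such that the following holds. Let $n,m,k$ be positive integers with $nk\ge2$, let $A\in\mathbb Z^{m\times n}$, $b\in\mathbb Z^m$ be such that $P=\{x\in\mathbb R^n \mid Ax\le b\}$ is a $[0,k]$-polytope, let $\alpha$ be the largest absolute value of an entry of $A$, and assume $\alpha\le p(n,k)$. Let $c\in\mathbb Z^n$ and let $x^0$ be a vertex of $P$. Then the length of the simplex path generated by the iterative algorithm with input $(P,c,x^0)$ is at most $C\,n^2k\log(nk)$. In particular, if moreover $k=1$, the length is at most $C\,n^2\log n$.
   Context: A lattice polytope is a polytope all of whose vertices have integer coordinates. A $[0,k]$-polytope in $\mathbb R^n$ is a lattice polytope contained in $[0,k]^n$. $\log$ denotes the logarithm in base $2$. $[m]:=\{1,\dots,m\}$, and $a_i^\top$ denotes the $i$-th row of $A$. Oracle: given a polytope $Q\subseteq\mathbb R^n$, a vector $w\in\mathbb Z^n$, and a vertex $v$ of $Q$, it either states that $v$ maximizes $w^\top x$ over $Q$ (when this is the case), or returns a vertex $v'$ of $Q$ adjacent to $v$ (i.e., joined to $v$ by an edge of $Q$) with $w^\top v'>w^\top v$. If $v$ is not optimal, any such adjacent vertex may be returned; the result holds for every choice. Basic algorithm$(Q,w,v)$: set $v^0:=v$; for $t=0,1,2,\dots$ call the oracle on $(Q,w,v^t)$; if it states that $v^t$ is optimal, return $v^t$; otherwise let $v^{t+1}$ be the vertex returned by the oracle. Scaling algorithm$(Q,w,v)$, for a $[0,k]$-polytope $Q$ and $w\neq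 0$: let $\ell:=\lceil\log\|w\|_\infty\rceil$ and $w^t:=\lceil w/2^{\ell-t}\rceil$ (componentwise) for $t=0,\dots,\ell$. Set $v^{(0)}:=v$, and for $t=0,\dots,\ell$ set $v^{(t+1)}:=$ basic algorithm$(Q,w^t,v^{(t)})$. Return $v^{(\ell+1)}$. Iterative algorithm$(P,c,x^0)$: Step 0. Let $\mathcal E:=\emptyset$ and $x^*:=x^0$. Step 1. Let $\bar c$ be the orthogonal projection of $c$ onto the subspace $\{x\in\mathbb R^n\mid a_i^\top x=0 \text{ for } i\in\mathcal E\}$. If $\bar c=0$ return $x^*$; otherwise go to Step 2. Step 2. Let $\tilde c\in\mathbb Z^n$ be defined by $\tilde c_i:=\left\lfloor \frac{n^3k\alpha}{\|\bar c\|_\infty}\bar c_i\right\rfloor$ for $i=1,\dots,n$. Step 3. Consider the primal/dual pair of linear programs $$(\tilde P)\quad \max\{\tilde c^\top x \mid a_i^\top x=b_i\ (i\in\mathcal E),\ a_i^\top x\le b_i\ (i\in[m]\setminus\mathcal E)\},$$ $$(\tilde D)\quad \min\{b^\top y\mid A^\top y=\tilde c,\ y_i\ge 0\ (i\in[m]\setminus\mathcal E)\}.$$ Use the scaling algorithm on the feasible region of $(\tilde P)$ with cost $\tilde c$, starting from $x^*$, to compute an optimal vertex $\tilde x$ of $(\tilde P)$. Compute an optimal solution $\tilde y$ of $(\tilde D)$ such that (i) $\tilde y$ has at most $n$ nonzero components, and (ii) $\tilde y_j=0$ for every $j\in[m]\setminus\mathcal E$ such that $a_j$ is a linear combination of the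 $a_i$, $i\in\mathcal E$. Let $\mathcal H:=\{i\mid \tilde y_i>nk\}$ and let $h\in\mathcal H\setminus\mathcal E$. Add $h$ to $\mathcal E$, set $x^*:=\tilde x$, and go back to Step 1. The simplex path generated by an algorithm is the sequence of successive vertices obtained by concatenating all the oracle moves it performs; its length is the number of edges traversed (the number of oracle calls returning a new vertex). *)

theory Defs
  imports "HOL-Analysis.Analysis" "HOL-Analysis.Finite_Function_Topology"
begin

text \<open>
  The dimension has to be quantified after the constant of the main result, so it cannot be
  a type. Vectors are finitely supported functions on \<open>nat\<close>, for which the library provides a
  real vector space and hence \<open>span\<close>, \<open>polytope\<close>, \<open>extreme_point_of\<close> and \<open>face_of\<close>; \<open>\<real>\<^sup>n\<close> is the
  subspace of those supported on the coordinates \<open>0, \<dots>, n - 1\<close>. Rows of matrices are likewise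
  indexed from 0, and \<open>A i\<close> is the \<open>i\<close>-th row of the matrix \<open>A\<close>.
\<close>

type_synonym vector = "nat \<Rightarrow>\<^sub>0 real"

definition real_space :: "nat \<Rightarrow> vector set" where
  "real_space n = {x. Poly_Mapping.keys x \<subseteq> {..<n}}"

definition int_lattice :: "nat \<Rightarrow> vector set" where
  "int_lattice n = {x \<in> real_space n. \<forall>i. Poly_Mapping.lookup x i \<in> \<int>}"

definition dot :: "vector \<Rightarrow> vector \<Rightarrow> real" where
  "dot x y = (\<Sum>i\<in>Poly_Mapping.keys x. Poly_Mapping.lookup x i * Poly_Mapping.lookup y i)"

definition sup_norm :: "vector \<Rightarrow> real" where
  "sup_norm x = (SUP i. \<bar>Poly_Mapping.lookup x i\<bar>)"

definition max_abs_entry :: "nat \<Rightarrow> nat \<Rightarrow> (nat \<Rightarrow> vector) \<Rightarrow> real" where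
  "max_abs_entry m n A = Max {\<bar>Poly_Mapping.lookup (A i) j\<bar> | i j. i < m \<and> j < n}"

definition lattice_polytope :: "nat \<Rightarrow> vector set \<Rightarrow> bool" where
  "lattice_polytope n Q \<longleftrightarrow>
     polytope Q \<and> Q \<subseteq> real_space n \<and> (\<forall>v. v extreme_point_of Q \<longrightarrow> v \<in> int_lattice n)"

definition box_polytope :: "nat \<Rightarrow> nat \<Rightarrow> vector set \<Rightarrow> bool" where
  "box_polytope n k Q \<longleftrightarrow>
     lattice_polytope n Q \<and>
     (\<forall>x\<in>Q. \<forall>i<n. 0 \<le> Poly_Mapping.lookup x i \<and> Poly_Mapping.lookup x i \<le> real k)"

text \<open>An edge is a one-dimensional face, that is, a face that is a nondegenerate segment.\<close>

definition adjacent_vertices :: "vector set \<Rightarrow> vector \<Rightarrow> vector \<Rightarrow> bool" where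
  "adjacent_vertices Q v v' \<longleftrightarrow>
     v extreme_point_of Q \<and> v' extreme_point_of Q \<and> v \<noteq> v' \<and> closed_segment v v' face_of Q"

text \<open>
  The algorithms make arbitrary choices, so they are described by relations. A path is the
  nonempty list of the vertices visited so far, with the current vertex last. Predicates ending
  in \<open>_path\<close> hold of the paths generated at any moment of a possibly unfinished (or even
  nonterminating) execution, those ending in \<open>_run\<close> of the paths of executions that have returned
  the last vertex of the path. When a subroutine is started at the end of a path \<open>p\<close> and
  generates \<open>q\<close>, the concatenated path is \<open>p @ tl q\<close>, because the head of \<open>q\<close> is the last
  vertex of \<open>p\<close>.
\<close>

definition oracle_optimal :: "vector set \<Rightarrow> vector \<Rightarrow> vector \<Rightarrow> bool" where
  "oracle_optimal Q w v \<longleftrightarrow> v extreme_point_of Q \<and> (\<forall>x\<in>Q. dot w x \<le> dot w v)"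

definition oracle_move :: "vector set \<Rightarrow> vector \<Rightarrow> vector \<Rightarrow> vector \<Rightarrow> bool" where
  "oracle_move Q w v v' \<longleftrightarrow> adjacent_vertices Q v v' \<and> dot w v < dot w v'"

inductive basic_path :: "vector set \<Rightarrow> vector \<Rightarrow> vector \<Rightarrow> vector list \<Rightarrow> bool"
  for Q w v where
  start: "basic_path Q w v [v]"
| move: "basic_path Q w v p \<Longrightarrow> oracle_move Q w (last p) v' \<Longrightarrow> basic_path Q w v (p @ [v'])"

definition basic_run :: "vector set \<Rightarrow> vector \<Rightarrow> vector \<Rightarrow> vector list \<Rightarrow> bool" where
  "basic_run Q w v p \<longleftrightarrow> basic_path Q w v p \<and> oracle_optimal Q w (last p)"

definition scaling_length :: "vector \<Rightarrow> nat" where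
  "scaling_length w = nat \<lceil>log 2 (sup_norm w)\<rceil>"

text \<open>
  \<open>Poly_Mapping.map f\<close> applies \<open>f\<close> to the nonzero entries only, which makes no difference here
  and in \<open>rounded_cost\<close> since rounding preserves 0.
\<close>

definition scaled_cost :: "vector \<Rightarrow> nat \<Rightarrow> vector" where
  "scaled_cost w t =
     Poly_Mapping.map (\<lambda>s. real_of_int \<lceil>s / 2 ^ (scaling_length w - t)\<rceil>) w"

text \<open>\<open>scaling_phases Q w v t p\<close>: the phases \<open>0, \<dots>, t - 1\<close> have been completed.\<close>

inductive scaling_phases ::
  "vector set \<Rightarrow> vector \<Rightarrow> vector \<Rightarrow> nat \<Rightarrow> vector list \<Rightarrow> bool"
  for Q w v where
  start: "scaling_phases Q w v 0 [v]"
| phase: "scaling_phases Q w v t p \<Longrightarrow> t \<le> scaling_length w \<Longrightarrow>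
    basic_run Q (scaled_cost w t) (last p) q \<Longrightarrow> scaling_phases Q w v (Suc t) (p @ tl q)"

definition scaling_run :: "vector set \<Rightarrow> vector \<Rightarrow> vector \<Rightarrow> vector list \<Rightarrow> bool" where
  "scaling_run Q w v p \<longleftrightarrow> scaling_phases Q w v (Suc (scaling_length w)) p"

inductive scaling_path :: "vector set \<Rightarrow> vector \<Rightarrow> vector \<Rightarrow> vector list \<Rightarrow> bool"
  for Q w v where
  between_phases: "scaling_phases Q w v t p \<Longrightarrow> scaling_path Q w v p"
| in_phase: "scaling_phases Q w v t p \<Longrightarrow> t \<le> scaling_length w \<Longrightarrow>
    basic_path Q (scaled_cost w t) (last p) q \<Longrightarrow> scaling_path Q w v (p @ tl q)"

definition polyhedron_of :: "nat \<Rightarrow> nat \<Rightarrow> (nat \<Rightarrow> vector) \<Rightarrow> vector \<Rightarrow> vector set" where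
  "polyhedron_of m n A b =
     {x \<in> real_space n. \<forall>i<m. dot (A i) x \<le> Poly_Mapping.lookup b i}"

definition primal_region ::
  "nat \<Rightarrow> nat \<Rightarrow> (nat \<Rightarrow> vector) \<Rightarrow> vector \<Rightarrow> nat set \<Rightarrow> vector set" where
  "primal_region m n A b E =
     {x \<in> real_space n. (\<forall>i\<in>E. dot (A i) x = Poly_Mapping.lookup b i) \<and>
        (\<forall>i\<in>{..<m} - E. dot (A i) x \<le> Poly_Mapping.lookup b i)}"

definition dual_region :: "nat \<Rightarrow> (nat \<Rightarrow> vector) \<Rightarrow> nat set \<Rightarrow> vector \<Rightarrow> vector set" where
  "dual_region m A E w =
     {y \<in> real_space m. (\<Sum>i<m. Poly_Mapping.lookup y i *\<^sub>R A i) = w \<and>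
        (\<forall>i\<in>{..<m} - E. 0 \<le> Poly_Mapping.lookup y i)}"

definition admissible_dual ::
  "nat \<Rightarrow> nat \<Rightarrow> (nat \<Rightarrow> vector) \<Rightarrow> vector \<Rightarrow> nat set \<Rightarrow> vector \<Rightarrow> vector \<Rightarrow> bool" where
  "admissible_dual m n A b E w y \<longleftrightarrow>
     y \<in> dual_region m A E w \<and> (\<forall>z\<in>dual_region m A E w. dot b y \<le> dot b z) \<and>
     card (Poly_Mapping.keys y) \<le> n \<and>
     (\<forall>j\<in>{..<m} - E. A j \<in> span (A ` E) \<longrightarrow> Poly_Mapping.lookup y j = 0)"

definition orthogonal_projection :: "vector set \<Rightarrow> vector \<Rightarrow> vector \<Rightarrow> bool" where
  "orthogonal_projection S c c' \<longleftrightarrow> c' \<in> S \<and> (\<forall>s\<in>S. dot (c - c') s = 0)"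

definition projected_cost ::
  "nat \<Rightarrow> (nat \<Rightarrow> vector) \<Rightarrow> nat set \<Rightarrow> vector \<Rightarrow> vector \<Rightarrow> bool" where
  "projected_cost n A E c c' \<longleftrightarrow>
     orthogonal_projection {x \<in> real_space n. \<forall>i\<in>E. dot (A i) x = 0} c c'"

definition rounded_cost ::
  "nat \<Rightarrow> nat \<Rightarrow> nat \<Rightarrow> (nat \<Rightarrow> vector) \<Rightarrow> vector \<Rightarrow> vector" where
  "rounded_cost m n k A c' =
     Poly_Mapping.map
       (\<lambda>s. real_of_int \<lfloor>real n ^ 3 * real k * max_abs_entry m n A / sup_norm c' * s\<rfloor>) c'"

text \<open>\<open>iterative_rounds m n k A b c x0 E p\<close>: Step 1 is reached with the set \<open>E\<close> and \<open>x\<^sup>* = last p\<close>.\<close>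

inductive iterative_rounds ::
  "nat \<Rightarrow> nat \<Rightarrow> nat \<Rightarrow> (nat \<Rightarrow> vector) \<Rightarrow> vector \<Rightarrow> vector \<Rightarrow> vector \<Rightarrow>
    nat set \<Rightarrow> vector list \<Rightarrow> bool"
  for m n k A b c x0 where
  start: "iterative_rounds m n k A b c x0 {} [x0]"
| round: "iterative_rounds m n k A b c x0 E p \<Longrightarrow>
    projected_cost n A E c c' \<Longrightarrow> c' \<noteq> 0 \<Longrightarrow>
    scaling_run (primal_region m n A b E) (rounded_cost m n k A c') (last p) q \<Longrightarrow>
    admissible_dual m n A b E (rounded_cost m n k A c') y \<Longrightarrow>
    h < m \<Longrightarrow> real n * real k < Poly_Mapping.lookup y h \<Longrightarrow> h \<notin> E \<Longrightarrow>
    iterative_rounds m n k A b c x0 (insert h E) (p @ tl q)"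

inductive iterative_path ::
  "nat \<Rightarrow> nat \<Rightarrow> nat \<Rightarrow> (nat \<Rightarrow> vector) \<Rightarrow> vector \<Rightarrow> vector \<Rightarrow> vector \<Rightarrow> vector list \<Rightarrow> bool"
  for m n k A b c x0 where
  at_step1: "iterative_rounds m n k A b c x0 E p \<Longrightarrow> iterative_path m n k A b c x0 p"
| in_step3: "iterative_rounds m n k A b c x0 E p \<Longrightarrow>
    projected_cost n A E c c' \<Longrightarrow> c' \<noteq> 0 \<Longrightarrow>
    scaling_path (primal_region m n A b E) (rounded_cost m n k A c') (last p) q \<Longrightarrow>
    iterative_path m n k A b c x0 (p @ tl q)"

definition path_length :: "vector list \<Rightarrow> nat" where
  "path_length p = length p - 1"

text \<open>A polynomial in two variables is a polynomial whose coefficients are polynomials.\<close>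

definition poly2 :: "real poly poly \<Rightarrow> real \<Rightarrow> real \<Rightarrow> real" where
  "poly2 p x y = poly (poly p [:y:]) x"

end

theory Submission
  imports Defs
begin

text \<open>
  All vertices met are integral points of \<open>[0,k]\<^sup>n\<close>, because the feasible regions are faces of
  the given polytope, and the rounded costs are integral, so every oracle move gains at least 1.
  A vertex that is optimal for the previous scaled cost is within \<open>nk\<close> of the optimum for the
  next one, so every phase makes at most \<open>nk\<close> moves, and the number of phases is logarithmic in
  the size of the cost, hence \<open>O(log (nk))\<close>. A dual solution vanishes on the rows in the span of
  the rows indexed by \<open>\<E>\<close>, so every round enlarges that span, and \<open>\<E>\<close> spans everything after at
  most \<open>n\<close> rounds.
\<close>

section \<open>Finitely supported vectors\<close>

lemma lookup_scaleR: "Poly_Mapping.lookup (r *\<^sub>R x) i = r *\<^sub>R Poly_Mapping.lookup x i"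
proof -
  have "finite {i. r *\<^sub>R Poly_Mapping.lookup x i \<noteq> 0}"
    by (rule finite_subset[OF _ finite_lookup[of x]]) auto
  then show ?thesis
    by (simp add: scaleR_poly_mapping_def Abs_poly_mapping_inverse)
qed

lemma lookup_map_zero:
  "f 0 = 0 \<Longrightarrow> Poly_Mapping.lookup (Poly_Mapping.map f x) i = f (Poly_Mapping.lookup x i)"
  by (simp add: Poly_Mapping.map.rep_eq when_def)

lemma lookup_eq_0_outside: "x \<in> real_space n \<Longrightarrow> \<not> i < n \<Longrightarrow> Poly_Mapping.lookup x i = 0"
  by (auto simp: real_space_def in_keys_iff)

text \<open>\<open>dot\<close> sums over the support of its left argument, so it is visibly linear
  only on the right. A range of indices shared by all vectors gives access to symmetry and to
  linearity on the left.\<close>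

lemma dot_eq_sum:
  assumes "x \<in> real_space n"
  shows "dot x y = (\<Sum>i<n. Poly_Mapping.lookup x i * Poly_Mapping.lookup y i)"
  unfolding dot_def using assms
  by (intro sum.mono_neutral_left) (auto simp: real_space_def in_keys_iff)

lemma dot_add_right: "dot x (y + z) = dot x y + dot x z"
  by (simp add: dot_def lookup_add algebra_simps sum.distrib)

lemma dot_scaleR_right: "dot x (r *\<^sub>R y) = r * dot x y"
  by (simp add: dot_def lookup_scaleR algebra_simps sum_distrib_left)

lemma dot_commute: "x \<in> real_space n \<Longrightarrow> y \<in> real_space n \<Longrightarrow> dot x y = dot y x"
  by (simp add: dot_eq_sum mult.commute)

lemma dot_self_eq_0D:
  assumes "dot x x = 0"
  shows "x = 0"
proof (rule poly_mapping_eqI)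
  fix i
  have "\<forall>i\<in>Poly_Mapping.keys x. Poly_Mapping.lookup x i * Poly_Mapping.lookup x i = 0"
    using assms unfolding dot_def by (subst (asm) sum_nonneg_eq_0_iff) auto
  then show "Poly_Mapping.lookup x i = Poly_Mapping.lookup 0 i"
    by (auto simp: in_keys_iff)
qed

lemma dot_in_Ints:
  assumes "x \<in> int_lattice n" "y \<in> int_lattice n"
  shows "dot x y \<in> \<int>"
  using assms by (auto simp: dot_def int_lattice_def)

text \<open>The ambient type has infinite dimension. This finite spanning set is what bounds the
  size of independent sets, and with it the number of rounds.\<close>

lemma real_space_subset_span: "real_space n \<subseteq> span ((\<lambda>i. Poly_Mapping.single i 1) ` {..<n})"
proof
  fix x :: vector
  assume x: "x \<in> real_space n"
  have "x = (\<Sum>i<n. Poly_Mapping.lookup x i *\<^sub>R Poly_Mapping.single i 1)"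
    using lookup_eq_0_outside[OF x]
    by (intro poly_mapping_eqI) (auto simp: lookup_sum lookup_scaleR lookup_single when_def if_distrib cong: if_cong)
  moreover have "\<dots> \<in> span ((\<lambda>i. Poly_Mapping.single i 1) ` {..<n})"
    by (intro span_sum span_scale span_base) auto
  ultimately show "x \<in> span ((\<lambda>i. Poly_Mapping.single i 1) ` {..<n})"
    by simp
qed

lemma card_independent_le:
  assumes "independent S" "S \<subseteq> real_space n"
  shows "card S \<le> n"
proof -
  have "card S \<le> card ((\<lambda>i. Poly_Mapping.single i (1::real)) ` {..<n})"
    using independent_span_bound[OF _ assms(1)] assms(2) real_space_subset_span
    by (meson finite_imageI finite_lessThan subset_trans)
  also have "\<dots> \<le> n"
    using card_image_le[of "{..<n}"] by simp
  finally show ?thesis .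
qed

text \<open>The supremum in \<open>sup_norm\<close> runs over all naturals; finite support bounds it
  by the sum of the absolute values.\<close>

lemma bdd_above_lookup: "bdd_above (range (\<lambda>i. \<bar>Poly_Mapping.lookup x i\<bar>))" for x :: vector
proof (rule bdd_aboveI2)
  fix i
  show "\<bar>Poly_Mapping.lookup x i\<bar> \<le> (\<Sum>j\<in>Poly_Mapping.keys x. \<bar>Poly_Mapping.lookup x j\<bar>)"
  proof (cases "i \<in> Poly_Mapping.keys x")
    case True
    then show ?thesis by (intro member_le_sum) auto
  qed (auto simp: in_keys_iff intro: sum_nonneg)
qed

lemma abs_lookup_le_sup_norm: "\<bar>Poly_Mapping.lookup x i\<bar> \<le> sup_norm x"
  unfolding sup_norm_def by (rule cSUP_upper[OF _ bdd_above_lookup]) simp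

lemma sup_norm_le: "(\<And>i. \<bar>Poly_Mapping.lookup x i\<bar> \<le> B) \<Longrightarrow> sup_norm x \<le> B"
  unfolding sup_norm_def by (rule cSUP_least) auto

lemma sup_norm_nonneg: "0 \<le> sup_norm x"
  using abs_lookup_le_sup_norm[of x 0] by linarith

lemma sup_norm_pos:
  assumes "x \<noteq> 0"
  shows "0 < sup_norm x"
proof -
  obtain i where "Poly_Mapping.lookup x i \<noteq> 0"
    using assms by (metis lookup_zero poly_mapping_eqI)
  then show ?thesis using abs_lookup_le_sup_norm[of x i] by linarith
qed

section \<open>Vertices in a lattice box\<close>

text \<open>The length bounds see the geometry of a region only through its vertices lying in this
  set.\<close>

definition lattice_box :: "nat \<Rightarrow> nat \<Rightarrow> vector set" where
  "lattice_box n k =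
     {v \<in> int_lattice n. \<forall>i<n. 0 \<le> Poly_Mapping.lookup v i \<and> Poly_Mapping.lookup v i \<le> real k}"

text \<open>Each coordinate changes by at most \<open>k\<close> and has weight at most 1. This is
  the source of the \<open>nk\<close> moves per phase.\<close>

lemma lattice_box_diff_le:
  assumes "v \<in> lattice_box n k" "v' \<in> lattice_box n k" "w \<in> real_space n"
    and "\<And>i. \<bar>Poly_Mapping.lookup w i\<bar> \<le> 1"
  shows "dot w v' - dot w v \<le> real n * real k"
proof -
  have "dot w v' - dot w v =
      (\<Sum>i<n. Poly_Mapping.lookup w i * (Poly_Mapping.lookup v' i - Poly_Mapping.lookup v i))"
    using assms(3) by (simp add: dot_eq_sum sum_subtractf algebra_simps)
  also have "\<dots> \<le> (\<Sum>i<n. real k)"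
  proof (rule sum_mono)
    fix i assume "i \<in> {..<n}"
    then have "\<bar>Poly_Mapping.lookup v' i - Poly_Mapping.lookup v i\<bar> \<le> real k"
      using assms(1,2) unfolding lattice_box_def by force
    then have "\<bar>Poly_Mapping.lookup w i * (Poly_Mapping.lookup v' i - Poly_Mapping.lookup v i)\<bar>
        \<le> 1 * real k"
      unfolding abs_mult using assms(4) by (intro mult_mono) auto
    then show "Poly_Mapping.lookup w i * (Poly_Mapping.lookup v' i - Poly_Mapping.lookup v i)
        \<le> real k"
      by linarith
  qed
  finally show ?thesis by simp
qed

text \<open>Turning valid inequalities into equations cuts out a face, and the vertices of a face
  are vertices of the whole polyhedron.\<close>

lemma extreme_point_of_primal_region:
  assumes "E \<subseteq> {..<m}" "v extreme_point_of primal_region m n A b E"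
  shows "v extreme_point_of polyhedron_of m n A b"
  unfolding extreme_point_of_def
proof (intro conjI ballI notI)
  have sub: "primal_region m n A b E \<subseteq> polyhedron_of m n A b"
    by (fastforce simp: primal_region_def polyhedron_of_def)
  have v: "v \<in> primal_region m n A b E"
    using assms(2) by (simp add: extreme_point_of_def)
  then show "v \<in> polyhedron_of m n A b"
    using sub by blast
  fix x y
  assume x: "x \<in> polyhedron_of m n A b" and y: "y \<in> polyhedron_of m n A b"
    and seg: "v \<in> open_segment x y"
  obtain u where u: "0 < u" "u < 1" and v_eq: "v = (1 - u) *\<^sub>R x + u *\<^sub>R y"
    using seg by (auto simp: in_segment)
  have tight: "dot (A i) x = Poly_Mapping.lookup b i \<and> dot (A i) y = Poly_Mapping.lookup b i"
    if "i \<in> E" for i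
  proof -
    let ?\<beta> = "Poly_Mapping.lookup b i"
    have le: "0 \<le> ?\<beta> - dot (A i) x" "0 \<le> ?\<beta> - dot (A i) y"
      using that assms(1) x y by (auto simp: polyhedron_of_def)
    have "dot (A i) v = ?\<beta>"
      using v that by (simp add: primal_region_def)
    \<comment> \<open>The slack at \<open>v\<close> is a convex combination, with positive weights,
      of the nonnegative slacks at \<open>x\<close> and \<open>y\<close>. It is 0, so both slacks
      are 0.\<close>
    then have "(1 - u) * (?\<beta> - dot (A i) x) + u * (?\<beta> - dot (A i) y) = 0"
      unfolding v_eq dot_add_right dot_scaleR_right by (simp add: algebra_simps)
    moreover have "0 \<le> (1 - u) * (?\<beta> - dot (A i) x)" "0 \<le> u * (?\<beta> - dot (A i) y)"
      using u le by simp_all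
    ultimately have "(1 - u) * (?\<beta> - dot (A i) x) = 0" "u * (?\<beta> - dot (A i) y) = 0"
      by linarith+
    then show ?thesis using u by simp
  qed
  then have "x \<in> primal_region m n A b E" "y \<in> primal_region m n A b E"
    using x y by (auto simp: polyhedron_of_def primal_region_def)
  then show False
    using assms(2) seg by (auto simp: extreme_point_of_def)
qed

lemma extreme_points_in_lattice_box:
  assumes "box_polytope n k (polyhedron_of m n A b)" "E \<subseteq> {..<m}"
  shows "{v. v extreme_point_of primal_region m n A b E} \<subseteq> lattice_box n k"
proof clarify
  fix v
  assume "v extreme_point_of primal_region m n A b E"
  then have "v extreme_point_of polyhedron_of m n A b"
    using assms(2) by (rule extreme_point_of_primal_region[rotated])
  then show "v \<in> lattice_box n k"
    using assms(1)
    by (auto simp: box_polytope_def lattice_polytope_def lattice_box_def extreme_point_of_def)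
qed

section \<open>The length of a scaling run\<close>

lemma path_length_append_tl:
  "p \<noteq> [] \<Longrightarrow> q \<noteq> [] \<Longrightarrow> path_length (p @ tl q) = path_length p + path_length q"
  by (cases p; cases q) (auto simp: path_length_def)

lemma last_append_tl: "q \<noteq> [] \<Longrightarrow> hd q = last p \<Longrightarrow> last (p @ tl q) = last q"
  by (cases q) auto

lemma basic_path_hd: "basic_path Q w v p \<Longrightarrow> p \<noteq> [] \<and> hd p = v"
  by (induction rule: basic_path.induct) auto

text \<open>A strict increase between integers is at least 1. The first disjunct handles the path
  without moves, whose start is not assumed to be a vertex.\<close>

lemma basic_path_gain:
  assumes "basic_path Q w v p" "w \<in> int_lattice n"
    and Q: "{v. v extreme_point_of Q} \<subseteq> lattice_box n k"
  shows "path_length p = 0 \<and> last p = v \<or>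
    v extreme_point_of Q \<and> last p extreme_point_of Q \<and>
      dot w v + real (path_length p) \<le> dot w (last p)"
  using assms(1)
proof (induction rule: basic_path.induct)
  case (move p v')
  let ?u = "last p"
  have ext: "?u extreme_point_of Q" "v' extreme_point_of Q" and less: "dot w ?u < dot w v'"
    using move.hyps(2) by (auto simp: oracle_move_def adjacent_vertices_def)
  have "dot w v' \<in> \<int>" "dot w ?u \<in> \<int>"
    using ext Q by (auto intro!: dot_in_Ints[OF assms(2)] simp: lattice_box_def)
  then have "dot w ?u + 1 \<le> dot w v'"
    using less by (auto elim!: Ints_cases)
  moreover have "path_length (p @ [v']) = Suc (path_length p)"
    using basic_path_hd[OF move.hyps(1)] by (cases p) (auto simp: path_length_def)
  ultimately show ?case
    using ext move.IH by auto
qed (simp add: path_length_def)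

text \<open>Moves are paid for by the gain still available at the start; \<open>0 \<le> B\<close>
  serves the path without moves. Optimality of the last vertex is not assumed, so unfinished
  executions are covered.\<close>

lemma basic_path_length_le:
  assumes "basic_path Q w v p" "w \<in> int_lattice n"
    and "{v. v extreme_point_of Q} \<subseteq> lattice_box n k"
    and "\<And>v'. v extreme_point_of Q \<Longrightarrow> v' extreme_point_of Q \<Longrightarrow> dot w v' - dot w v \<le> B"
    and "0 \<le> B"
  shows "real (path_length p) \<le> B"
  using basic_path_gain[OF assms(1-3)] assms(4)[of "last p"] assms(5) by auto

section \<open>Scaled costs and their successive differences\<close>

lemma le_two_power_nat_ceiling_log: "s \<le> 2 ^ nat \<lceil>log 2 s\<rceil>"
proof (cases "0 < s")
  case True
  \<comment> \<open>For \<open>s < 1\<close> the logarithm is negative and \<open>nat\<close>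
    truncates its ceiling to 0 or leaves 0, which keeps the inequality.\<close>
  have "log 2 s \<le> real (nat \<lceil>log 2 s\<rceil>)" by linarith
  then have "s \<le> 2 powr real (nat \<lceil>log 2 s\<rceil>)"
    using True by (simp add: log_le_iff)
  then show ?thesis by (simp add: powr_realpow)
next
  case False
  then show ?thesis by (meson dual_order.trans linorder_not_less zero_le_numeral zero_le_power)
qed

lemma lookup_scaled_cost:
  "Poly_Mapping.lookup (scaled_cost w t) i =
     real_of_int \<lceil>Poly_Mapping.lookup w i / 2 ^ (scaling_length w - t)\<rceil>"
  by (simp add: scaled_cost_def lookup_map_zero)

lemma scaled_cost_in_int_lattice:
  assumes "w \<in> real_space n"
  shows "scaled_cost w t \<in> int_lattice n"
proof -
  have "i < n" if "i \<in> Poly_Mapping.keys (scaled_cost w t)" for i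
    using lookup_eq_0_outside[OF assms, of i] that
    by (cases "i < n") (auto simp: in_keys_iff lookup_scaled_cost)
  then show ?thesis
    by (auto simp: int_lattice_def real_space_def lookup_scaled_cost)
qed

text \<open>The initial divisor is a power of 2 no smaller than the sup norm, so the first phase has
  costs in -1, 0, 1.\<close>

lemma abs_lookup_scaled_cost_0: "\<bar>Poly_Mapping.lookup (scaled_cost w 0) i\<bar> \<le> 1"
proof -
  let ?z = "Poly_Mapping.lookup w i / 2 ^ scaling_length w"
  have "\<bar>Poly_Mapping.lookup w i\<bar> \<le> 2 ^ scaling_length w"
    using abs_lookup_le_sup_norm[of w i] le_two_power_nat_ceiling_log[of "sup_norm w"]
    by (simp add: scaling_length_def)
  then have "\<bar>?z\<bar> \<le> 1"
    by (simp add: abs_divide)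
  then have "-1 \<le> \<lceil>?z\<rceil>" "\<lceil>?z\<rceil> \<le> 1"
    by linarith+
  then have "real_of_int \<bar>\<lceil>?z\<rceil>\<bar> \<le> 1"
    unfolding of_int_le_1_iff by linarith
  then show ?thesis
    by (simp only: lookup_scaled_cost of_int_abs diff_zero)
qed

lemma abs_lookup_scaled_cost_Suc:
  assumes "Suc t \<le> scaling_length w"
  shows "\<bar>Poly_Mapping.lookup (scaled_cost w (Suc t) - 2 *\<^sub>R scaled_cost w t) i\<bar> \<le> 1"
proof -
  define z where "z = Poly_Mapping.lookup w i / 2 ^ (scaling_length w - Suc t)"
  \<comment> \<open>The hypothesis keeps the truncated subtraction exact, so the earlier divisor has
    precisely one more factor 2.\<close>
  have "scaling_length w - t = Suc (scaling_length w - Suc t)"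
    using assms by simp
  then have "Poly_Mapping.lookup w i / 2 ^ (scaling_length w - t) = z / 2"
    by (simp add: z_def)
  \<comment> \<open>Rounding up \<open>z / 2\<close> and doubling overshoots the rounding of
    \<open>z\<close> by 0 or 1.\<close>
  moreover have "real_of_int \<bar>\<lceil>z\<rceil> - 2 * \<lceil>z / 2\<rceil>\<bar> \<le> 1"
    unfolding of_int_le_1_iff by linarith
  ultimately show ?thesis
    by (simp only: lookup_minus lookup_scaleR real_scaleR_def lookup_scaled_cost
        of_int_abs of_int_diff of_int_mult of_int_numeral flip: z_def)
qed

text \<open>Doubling a cost does not change its maximizers, so the previous optimum can be improved
  only through the correction \<open>?d\<close>, whose entries are at most 1 in absolute value.
  Phase 0 has no predecessor: \<open>opt\<close> is vacuous there and the cost itself has such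
  entries.\<close>

lemma scaling_phase_length_le:
  assumes Q: "{v. v extreme_point_of Q} \<subseteq> lattice_box n k"
    and w: "w \<in> real_space n" and t: "t \<le> scaling_length w"
    and opt: "\<And>s. t = Suc s \<Longrightarrow> oracle_optimal Q (scaled_cost w s) v"
    and p: "basic_path Q (scaled_cost w t) v p"
  shows "real (path_length p) \<le> real n * real k"
proof (rule basic_path_length_le[OF p scaled_cost_in_int_lattice[OF w] Q])
  fix v'
  assume "v extreme_point_of Q" "v' extreme_point_of Q"
  then have v: "v \<in> lattice_box n k" "v' \<in> lattice_box n k" "v' \<in> Q"
    using Q by (auto simp: extreme_point_of_def)
  have lat: "scaled_cost w r \<in> real_space n" for r
    using scaled_cost_in_int_lattice[OF w] by (simp add: int_lattice_def)
  show "dot (scaled_cost w t) v' - dot (scaled_cost w t) v \<le> real n * real k"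
  proof (cases t)
    case 0
    then show ?thesis
      using lattice_box_diff_le[OF v(1,2) lat abs_lookup_scaled_cost_0] by simp
  next
    case (Suc s)
    let ?d = "scaled_cost w (Suc s) - 2 *\<^sub>R scaled_cost w s"
    have d: "?d \<in> real_space n"
      using lookup_eq_0_outside[OF lat]
      by (fastforce simp: real_space_def in_keys_iff lookup_minus lookup_scaleR)
    have "dot ?d x = dot (scaled_cost w (Suc s)) x - 2 * dot (scaled_cost w s) x" for x
      by (simp add: dot_eq_sum[OF d] dot_eq_sum[OF lat] lookup_minus lookup_scaleR
          left_diff_distrib sum_subtractf sum_distrib_left mult.assoc)
    moreover have "dot ?d v' - dot ?d v \<le> real n * real k"
      using t Suc by (intro lattice_box_diff_le[OF v(1,2) d abs_lookup_scaled_cost_Suc]) simp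
    moreover have "dot (scaled_cost w s) v' \<le> dot (scaled_cost w s) v"
      using opt[OF Suc] v(3) by (simp add: oracle_optimal_def)
    ultimately show ?thesis
      by (simp add: Suc)
  qed
qed simp

text \<open>The last conjunct carries optimality from one phase to the next; its bound on
  \<open>s\<close> later limits the number of completed phases.\<close>

lemma scaling_phases_length_le:
  assumes "scaling_phases Q w v t p"
    and Q: "{v. v extreme_point_of Q} \<subseteq> lattice_box n k" and w: "w \<in> real_space n"
  shows "p \<noteq> [] \<and> hd p = v \<and> real (path_length p) \<le> real t * (real n * real k) \<and>
    (\<forall>s. t = Suc s \<longrightarrow> s \<le> scaling_length w \<and> oracle_optimal Q (scaled_cost w s) (last p))"
  using assms(1)
proof (induction rule: scaling_phases.induct)
  case (phase t p q)
  have q: "basic_path Q (scaled_cost w t) (last p) q" and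
    opt: "oracle_optimal Q (scaled_cost w t) (last q)"
    using phase.hyps(3) by (auto simp: basic_run_def)
  have ne: "q \<noteq> []" "hd q = last p"
    using basic_path_hd[OF q] by auto
  have "real (path_length q) \<le> real n * real k"
    using phase by (intro scaling_phase_length_le[OF Q w _ _ q]) auto
  moreover have "path_length (p @ tl q) = path_length p + path_length q"
    using phase.IH ne by (simp add: path_length_append_tl)
  ultimately show ?case
    using phase.IH phase.hyps opt ne by (auto simp: last_append_tl algebra_simps)
qed (simp add: path_length_def)

lemma scaling_path_length_le:
  assumes "scaling_path Q w v p"
    and Q: "{v. v extreme_point_of Q} \<subseteq> lattice_box n k" and w: "w \<in> real_space n"
  shows "p \<noteq> [] \<and> hd p = v \<and>
    real (path_length p) \<le> real (Suc (scaling_length w)) * (real n * real k)"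
  using assms(1)
proof cases
  case (between_phases t)
  note * = scaling_phases_length_le[OF between_phases Q w]
  have "t \<le> Suc (scaling_length w)"
    using * by (cases t) auto
  then have "real t * (real n * real k) \<le> real (Suc (scaling_length w)) * (real n * real k)"
    by (intro mult_right_mono) auto
  then show ?thesis using * by linarith
next
  case (in_phase t p' q)
  note * = scaling_phases_length_le[OF in_phase(2) Q w]
  have "real (path_length q) \<le> real n * real k"
    using * by (intro scaling_phase_length_le[OF Q w in_phase(3) _ in_phase(4)]) auto
  moreover have "path_length p = path_length p' + path_length q"
    using * basic_path_hd[OF in_phase(4)] in_phase(1) by (simp add: path_length_append_tl)
  \<comment> \<open>The unfinished phase \<open>t\<close> is charged like a completed one; since
    \<open>t\<close> is at most the scaling length, the total stays within all phases.\<close>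
  ultimately have "real (path_length p) \<le> real (Suc t) * (real n * real k)"
    using * by (simp add: algebra_simps)
  also have "\<dots> \<le> real (Suc (scaling_length w)) * (real n * real k)"
    using in_phase(3) by (intro mult_right_mono) auto
  finally show ?thesis using * in_phase(1) by simp
qed

section \<open>The size of the rounded costs\<close>

lemma max_abs_entry_nonneg:
  assumes "0 < m" "0 < n"
  shows "0 \<le> max_abs_entry m n A"
proof -
  let ?S = "{\<bar>Poly_Mapping.lookup (A i) j\<bar> | i j. i < m \<and> j < n}"
  have "?S = (\<lambda>(i, j). \<bar>Poly_Mapping.lookup (A i) j\<bar>) ` ({..<m} \<times> {..<n})"
    by auto
  then have "finite ?S"
    by (simp only: finite_imageI finite_cartesian_product finite_lessThan)
  moreover have "\<bar>Poly_Mapping.lookup (A 0) 0\<bar> \<in> ?S"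
    using assms by blast
  ultimately have "\<bar>Poly_Mapping.lookup (A 0) 0\<bar> \<le> max_abs_entry m n A"
    unfolding max_abs_entry_def by (rule Max_ge)
  then show ?thesis by linarith
qed

lemma lookup_rounded_cost:
  "Poly_Mapping.lookup (rounded_cost m n k A c) i =
     real_of_int \<lfloor>real n ^ 3 * real k * max_abs_entry m n A / sup_norm c *
       Poly_Mapping.lookup c i\<rfloor>"
  by (simp add: rounded_cost_def lookup_map_zero)

lemma rounded_cost_in_real_space:
  assumes "c \<in> real_space n"
  shows "rounded_cost m n k A c \<in> real_space n"
proof -
  have "i < n" if "i \<in> Poly_Mapping.keys (rounded_cost m n k A c)" for i
    using lookup_eq_0_outside[OF assms, of i] that
    by (cases "i < n") (auto simp: in_keys_iff lookup_rounded_cost)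
  then show ?thesis
    by (auto simp: real_space_def)
qed

text \<open>Before rounding, the entries are at most the scaling factor in absolute value; the floor
  of a negative number can add up to 1.\<close>

lemma sup_norm_rounded_cost_le:
  assumes "0 \<le> max_abs_entry m n A" "c \<noteq> 0"
  shows "sup_norm (rounded_cost m n k A c) \<le> real n ^ 3 * real k * max_abs_entry m n A + 1"
proof (rule sup_norm_le)
  fix i
  let ?M = "real n ^ 3 * real k * max_abs_entry m n A"
  let ?z = "?M / sup_norm c * Poly_Mapping.lookup c i"
  have "\<bar>?z\<bar> = ?M * (\<bar>Poly_Mapping.lookup c i\<bar> / sup_norm c)"
    using assms sup_norm_nonneg[of c] by (simp add: abs_mult)
  also have "\<dots> \<le> ?M * 1"
    using assms sup_norm_pos[of c] abs_lookup_le_sup_norm[of c i]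
    by (intro mult_left_mono) (auto simp: divide_le_eq_1)
  finally have "?z \<le> ?M \<and> - ?z \<le> ?M"
    unfolding abs_le_iff by simp
  then have "\<bar>real_of_int \<lfloor>?z\<rfloor>\<bar> \<le> ?M + 1"
    unfolding abs_le_iff by linarith
  then show "\<bar>Poly_Mapping.lookup (rounded_cost m n k A c) i\<bar> \<le> ?M + 1"
    by (simp add: lookup_rounded_cost)
qed

text \<open>Taking \<open>B \<ge> 1\<close> covers the cost 0, for which \<open>log 2 0 = 0\<close>.\<close>

lemma scaling_length_le:
  assumes "sup_norm w \<le> B" "1 \<le> B"
  shows "real (scaling_length w) \<le> log 2 B + 1"
proof -
  have "log 2 (sup_norm w) \<le> log 2 B"
  proof (cases "sup_norm w = 0")
    case False
    then show ?thesis using assms sup_norm_nonneg[of w] by simp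
  qed (use assms in \<open>simp add: log_def\<close>)
  moreover have "0 \<le> log 2 B"
    using assms by simp
  ultimately show ?thesis
    unfolding scaling_length_def by linarith
qed

section \<open>Polynomial growth\<close>

lemma poly_le_power:
  fixes q :: "real poly"
  shows "\<exists>K d. 0 \<le> K \<and> (\<forall>x\<ge>1. \<bar>poly q x\<bar> \<le> K * x ^ d)"
proof (induction q)
  case 0
  show ?case by (intro exI[of _ 0]) auto
next
  case (pCons a q)
  then obtain K d where K: "0 \<le> K" "\<And>x. 1 \<le> x \<Longrightarrow> \<bar>poly q x\<bar> \<le> K * x ^ d"
    by blast
  have "\<bar>poly (pCons a q) x\<bar> \<le> (\<bar>a\<bar> + K) * x ^ Suc d" if "1 \<le> x" for x
  proof -
    have "\<bar>poly (pCons a q) x\<bar> \<le> \<bar>a\<bar> + x * \<bar>poly q x\<bar>"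
      using that abs_triangle_ineq[of a "x * poly q x"] by (simp add: abs_mult)
    \<comment> \<open>A Horner step: as \<open>1 \<le> x\<close>, the constant term can be raised to
      the new degree.\<close>
    also have "\<dots> \<le> \<bar>a\<bar> * x ^ Suc d + x * (K * x ^ d)"
      using that K one_le_power[OF that, of "Suc d"]
      by (intro add_mono mult_left_mono mult_le_cancel_left1[THEN iffD2]) auto
    finally show ?thesis by (simp add: algebra_simps)
  qed
  then show ?case using K(1) by (intro exI[of _ "\<bar>a\<bar> + K"] exI[of _ "Suc d"]) auto
qed

text \<open>Horner induction in \<open>y\<close>, with coefficients polynomial in \<open>x\<close>
  bounded by the univariate case. Since \<open>x\<close> and \<open>y\<close> are at least 1, both
  are at most \<open>x * y\<close>, so a power of the product suffices.\<close>

lemma poly2_le_power: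
  "\<exists>K d. 0 \<le> K \<and> (\<forall>x\<ge>1. \<forall>y\<ge>1. \<bar>poly2 p x y\<bar> \<le> K * (x * y) ^ d)"
proof (induction p)
  case 0
  show ?case by (intro exI[of _ 0]) (auto simp: poly2_def)
next
  case (pCons a p)
  then obtain K d where
    K: "0 \<le> K" "\<And>x y. 1 \<le> x \<Longrightarrow> 1 \<le> y \<Longrightarrow> \<bar>poly2 p x y\<bar> \<le> K * (x * y) ^ d"
    by blast
  obtain K' d' where K': "0 \<le> K'" "\<And>x. 1 \<le> x \<Longrightarrow> \<bar>poly a x\<bar> \<le> K' * x ^ d'"
    using poly_le_power[of a] by blast
  have "\<bar>poly2 (pCons a p) x y\<bar> \<le> (K' + K) * (x * y) ^ (d' + Suc d)" if "1 \<le> x" "1 \<le> y" for x y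
  proof -
    have xy: "x \<le> x * y" "y \<le> x * y" "1 \<le> x * y"
      using that by (auto simp: mult_le_cancel_left1 mult_le_cancel_right1 intro: mult_ge1_I)
    have "\<bar>poly2 (pCons a p) x y\<bar> \<le> \<bar>poly a x\<bar> + y * \<bar>poly2 p x y\<bar>"
      using that abs_triangle_ineq[of "poly a x" "y * poly2 p x y"]
      by (simp add: poly2_def abs_mult)
    also have "\<dots> \<le> K' * x ^ d' + (x * y) * (K * (x * y) ^ d)"
      using that K(2) K' xy mult_nonneg_nonneg[OF K(1) zero_le_power, of "x * y" d]
      by (intro add_mono mult_mono) auto
    also have "\<dots> = K' * x ^ d' + K * (x * y) ^ Suc d"
      by (simp add: algebra_simps)
    also have "\<dots> \<le> K' * (x * y) ^ d' + K * (x * y) ^ Suc d"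
      using that xy K(1) K'(1) by (intro add_mono mult_left_mono power_mono) auto
    also have "\<dots> \<le> K' * (x * y) ^ (d' + Suc d) + K * (x * y) ^ (d' + Suc d)"
      using xy K(1) K'(1) by (intro add_mono mult_left_mono power_increasing) auto
    finally show ?thesis by (simp add: algebra_simps)
  qed
  then show ?case
    using K(1) K'(1) by (intro exI[of _ "K' + K"] exI[of _ "d' + Suc d"]) auto
qed

text \<open>The cost is polynomial in \<open>nk\<close>, so its logarithm is of order
  \<open>log (nk)\<close>. In the factor, \<open>d + 3\<close> is the degree, \<open>K + 1\<close>
  absorbs the rounding error, and the remaining 2 comes from the ceiling and from counting phase
  0.\<close>

lemma scaling_length_rounded_cost_le:
  assumes "0 < m" "0 < n" "0 < k" "2 \<le> n * k" "0 \<le> K" "c \<noteq> 0"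
    and "max_abs_entry m n A \<le> K * (real n * real k) ^ d"
  shows "real (Suc (scaling_length (rounded_cost m n k A c)))
    \<le> (5 + real d + log 2 (K + 1)) * log 2 (real n * real k)"
proof -
  let ?N = "real n * real k"
  have N: "2 \<le> ?N"
    using assms(4) by (metis of_nat_le_iff of_nat_mult of_nat_numeral)
  have \<alpha>: "0 \<le> max_abs_entry m n A"
    using assms by (simp add: max_abs_entry_nonneg)
  have "real n ^ 3 * real k \<le> ?N ^ 3"
    using assms(3) self_le_power[of "real k" 3] by (simp add: power_mult_distrib mult_left_mono)
  then have "real n ^ 3 * real k * max_abs_entry m n A \<le> ?N ^ 3 * (K * ?N ^ d)"
    using assms \<alpha> by (intro mult_mono) auto
  also have "\<dots> = K * ?N ^ (d + 3)"
    by (simp add: power_add)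
  finally have "real n ^ 3 * real k * max_abs_entry m n A + 1 \<le> K * ?N ^ (d + 3) + ?N ^ (d + 3)"
    using N by (intro add_mono one_le_power) auto
  then have "sup_norm (rounded_cost m n k A c) \<le> (K + 1) * ?N ^ (d + 3)"
    using sup_norm_rounded_cost_le[OF \<alpha> assms(6), of k] by (simp add: algebra_simps)
  moreover have "1 \<le> (K + 1) * ?N ^ (d + 3)"
    using N assms(5) by (intro mult_ge1_I[of "K + 1"] one_le_power) auto
  ultimately have "real (scaling_length (rounded_cost m n k A c))
      \<le> log 2 ((K + 1) * ?N ^ (d + 3)) + 1"
    by (rule scaling_length_le)
  also have "\<dots> = log 2 (K + 1) + real (d + 3) * log 2 ?N + 1"
    using N assms(5) by (subst log_mult_pos) (auto simp: log_nat_power)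
  finally have "real (Suc (scaling_length (rounded_cost m n k A c)))
      \<le> (2 + log 2 (K + 1)) * 1 + (real d + 3) * log 2 ?N"
    by simp
  \<comment> \<open>As \<open>nk\<close> is at least 2, its logarithm is at least 1 and absorbs the
    additive constant.\<close>
  also have "\<dots> \<le> (2 + log 2 (K + 1)) * log 2 ?N + (real d + 3) * log 2 ?N"
    using N assms(5) by (intro add_right_mono mult_left_mono) (auto simp: le_log_iff)
  finally show ?thesis by (simp add: algebra_simps)
qed

section \<open>The number of rounds\<close>

text \<open>A nonzero vector orthogonal to the chosen rows lies outside their span and extends them
  to a larger independent set. Strictness leaves room for the round in progress.\<close>

lemma card_lt_of_projected_cost:
  assumes "projected_cost n A E c c'" "c' \<noteq> 0" "independent (A ` E)" "A ` E \<subseteq> real_space n"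
  shows "card (A ` E) < n"
proof -
  have c': "c' \<in> real_space n" "\<And>i. i \<in> E \<Longrightarrow> dot (A i) c' = 0"
    using assms(1) by (auto simp: projected_cost_def orthogonal_projection_def)
  have "subspace {x. dot c' x = 0}"
    by (rule subspaceI) (auto simp: dot_add_right dot_scaleR_right, simp add: dot_def)
  moreover have "A ` E \<subseteq> {x. dot c' x = 0}"
    using c' assms(4) by (auto simp: dot_commute[of c' n])
  ultimately have "c' \<notin> span (A ` E)"
    using span_minimal[of "A ` E" "{x. dot c' x = 0}"] dot_self_eq_0D[of c'] assms(2) by auto
  then have "independent (insert c' (A ` E))" "c' \<notin> A ` E"
    using assms(3) by (auto simp: independent_insert intro: span_base)
  moreover have "finite (A ` E)"
    using independent_span_bound[OF _ assms(3)] assms(4) real_space_subset_span[of n]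
    by (meson finite_imageI finite_lessThan subset_trans)
  ultimately show ?thesis
    using card_independent_le[of "insert c' (A ` E)" n] assms(4) c' by simp
qed

text \<open>Every round adds a row outside the span of the earlier ones, so the number of distinct
  chosen rows counts the completed rounds.\<close>

lemma iterative_rounds_length_le:
  assumes "iterative_rounds m n k A b c x0 E p"
    and P: "box_polytope n k (polyhedron_of m n A b)"
    and A: "\<And>i. i < m \<Longrightarrow> A i \<in> real_space n"
    and B: "\<And>c'. c' \<noteq> 0 \<Longrightarrow> real (Suc (scaling_length (rounded_cost m n k A c'))) \<le> B"
  shows "E \<subseteq> {..<m} \<and> independent (A ` E) \<and> p \<noteq> [] \<and>
    real (path_length p) \<le> real (card (A ` E)) * (B * (real n * real k))"
  using assms(1)
proof (induction rule: iterative_rounds.induct)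
  case (round E p c' q y h)
  have E: "E \<subseteq> {..<m}" "independent (A ` E)" "finite (A ` E)"
    using round.IH by (auto intro: finite_subset)
  have "A h \<notin> span (A ` E)"
  proof
    assume "A h \<in> span (A ` E)"
    \<comment> \<open>Condition (ii) on the dual solution, which contradicts an entry exceeding
      \<open>nk\<close>.\<close>
    then have "Poly_Mapping.lookup y h = 0"
      using round.hyps by (auto simp: admissible_dual_def)
    then show False
      using round.hyps(7) by (simp add: mult_less_0_iff)
  qed
  then have indep: "independent (A ` insert h E)" and
    card: "card (A ` insert h E) = Suc (card (A ` E))"
    using E by (auto simp: independent_insert card_insert_if span_base)
  have c': "c' \<in> real_space n"
    using round.hyps(2) by (auto simp: projected_cost_def orthogonal_projection_def)
  have "scaling_path (primal_region m n A b E) (rounded_cost m n k A c') (last p) q"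
    using round.hyps(4) unfolding scaling_run_def by (rule scaling_path.between_phases)
  note * = scaling_path_length_le[OF this extreme_points_in_lattice_box[OF P E(1)]
      rounded_cost_in_real_space[OF c']]
  have "real (path_length q) \<le> B * (real n * real k)"
    using * B[OF round.hyps(3)]
    by (meson mult_right_mono mult_nonneg_nonneg of_nat_0_le_iff order_trans)
  then have "real (path_length (p @ tl q)) \<le> real (card (A ` insert h E)) * (B * (real n * real k))"
    using round.IH * by (simp add: path_length_append_tl card algebra_simps del: image_insert)
  then show ?case
    using E(1) round.hyps(6) round.IH indep by simp
qed (simp add: path_length_def independent_empty)

lemma iterative_path_length_le:
  assumes "iterative_path m n k A b c x0 p"
    and P: "box_polytope n k (polyhedron_of m n A b)"
    and A: "\<And>i. i < m \<Longrightarrow> A i \<in> real_space n"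
    and B: "\<And>c'. c' \<noteq> 0 \<Longrightarrow> real (Suc (scaling_length (rounded_cost m n k A c'))) \<le> B"
    and "0 \<le> B"
  shows "real (path_length p) \<le> real n * (B * (real n * real k))"
  using assms(1)
proof cases
  case (at_step1 E)
  note * = iterative_rounds_length_le[OF at_step1 P A B]
  have "A ` E \<subseteq> real_space n"
    using * A by auto
  then have "card (A ` E) \<le> n"
    using * card_independent_le by blast
  then have "real (card (A ` E)) * (B * (real n * real k)) \<le> real n * (B * (real n * real k))"
    using assms(5) by (intro mult_right_mono) auto
  then show ?thesis using * by linarith
next
  case (in_step3 E p' c' q)
  note * = iterative_rounds_length_le[OF in_step3(2) P A B]
  have c': "c' \<in> real_space n"
    using in_step3(3) by (auto simp: projected_cost_def orthogonal_projection_def)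
  have E: "E \<subseteq> {..<m}"
    using * by blast
  note q = scaling_path_length_le[OF in_step3(5) extreme_points_in_lattice_box[OF P E]
      rounded_cost_in_real_space[OF c']]
  have "real (path_length q) \<le> B * (real n * real k)"
    using q B[OF in_step3(4)]
    by (meson mult_right_mono mult_nonneg_nonneg of_nat_0_le_iff order_trans)
  then have "real (path_length p) \<le> real (Suc (card (A ` E))) * (B * (real n * real k))"
    using * q in_step3(1) by (simp add: path_length_append_tl algebra_simps)
  also have "A ` E \<subseteq> real_space n"
    using * A by auto
  \<comment> \<open>The unfinished scaling run counts as one extra round, which the nonzero
    projected cost permits.\<close>
  then have "Suc (card (A ` E)) \<le> n"
    using card_lt_of_projected_cost[OF in_step3(3,4)] * by auto
  then have "real (Suc (card (A ` E))) * (B * (real n * real k)) \<le> real n * (B * (real n * real k))"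
    using assms(5) by (intro mult_right_mono) auto
  finally show ?thesis .
qed

theorem corollary1:
  fixes p :: "real poly poly"
  shows "\<exists>C>0. \<forall>(n::nat) (m::nat) (k::nat) A b c x0.
    n > 0 \<and> m > 0 \<and> k > 0 \<and> n * k \<ge> 2 \<and>
    (\<forall>i<m. A i \<in> int_lattice n) \<and> b \<in> int_lattice m \<and>
    box_polytope n k (polyhedron_of m n A b) \<and>
    max_abs_entry m n A \<le> poly2 p (real n) (real k) \<and>
    c \<in> int_lattice n \<and> x0 extreme_point_of (polyhedron_of m n A b) \<longrightarrow>
    (\<forall>vs. iterative_path m n k A b c x0 vs \<longrightarrow>
       real (path_length vs) \<le> C * (real n)\<^sup>2 * real k * log 2 (real n * real k) \<and>
       (k = 1 \<longrightarrow> real (path_length vs) \<le> C * (real n)\<^sup>2 * log 2 (real n)))"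
proof -
  obtain K d where
    K: "0 \<le> K" "\<And>x y. 1 \<le> x \<Longrightarrow> 1 \<le> y \<Longrightarrow> \<bar>poly2 p x y\<bar> \<le> K * (x * y) ^ d"
    using poly2_le_power[of p] by blast
  \<comment> \<open>\<open>K\<close> and \<open>d\<close> come from \<open>p\<close> alone, so this
    constant is fixed before the dimensions and the instance.\<close>
  define C where "C = 5 + real d + log 2 (K + 1)"
  have C: "0 < C"
    using K(1) by (simp add: C_def add_pos_nonneg)
  have bound: "real (path_length vs) \<le> C * (real n)\<^sup>2 * real k * log 2 (real n * real k)"
    if pos: "0 < n" "0 < m" "0 < k" "2 \<le> n * k" and A: "\<forall>i<m. A i \<in> int_lattice n"
      and P: "box_polytope n k (polyhedron_of m n A b)"
      and \<alpha>: "max_abs_entry m n A \<le> poly2 p (real n) (real k)"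
      and vs: "iterative_path m n k A b c x0 vs"
    for n m k :: nat and A b c x0 vs
  proof -
    have "max_abs_entry m n A \<le> K * (real n * real k) ^ d"
      using \<alpha> K(2)[of "real n" "real k"] pos by simp
    note len = scaling_length_rounded_cost_le[OF pos(2,1,3,4) K(1) _ this, folded C_def]
    have "1 \<le> real n * real k"
      using pos by (intro mult_ge1_I) auto
    then have "0 \<le> C * log 2 (real n * real k)"
      using C by simp
    then have "real (path_length vs) \<le> real n * (C * log 2 (real n * real k) * (real n * real k))"
      using A by (intro iterative_path_length_le[OF vs P _ len]) (auto simp: int_lattice_def)
    then show ?thesis
      by (simp add: power2_eq_square algebra_simps)
  qed
  show ?thesis
  proof (intro exI[of _ C] conjI C allI impI; elim conjE)
    fix n m k :: nat and A b c x0 vs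
    assume "0 < n" "0 < m" "0 < k" "2 \<le> n * k" "\<forall>i<m. A i \<in> int_lattice n"
      "box_polytope n k (polyhedron_of m n A b)"
      "max_abs_entry m n A \<le> poly2 p (real n) (real k)"
      "iterative_path m n k A b c x0 vs"
    note * = bound[OF this]
    then show "real (path_length vs) \<le> C * (real n)\<^sup>2 * real k * log 2 (real n * real k)" .
    show "real (path_length vs) \<le> C * (real n)\<^sup>2 * log 2 (real n)" if "k = 1"
      using * that by simp
  qed
qed

end
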